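(* (1) Let $E_e$ and $\tilde E_e$ be the systems of edge vectors on $(\mathcal N,\mathcal O,\mathfrak l)$ and on $(\tilde{\mathcal N},\mathcal O,\mathfrak l)$ respectively, where $\tilde{\mathcal N}$ is obtained from $\mathcal N$ by moving one internal trivalent white vertex $V$ (vertex gauge transformation), with incoming edge $e_3$ and outgoing edges $e_1,e_2$. Let $\tilde e_i$ denote the edge $e_i$ after the move, let $f_i$ ($i=1,2$) be an edge outgoing at the end vertex of $e_i$, and let $f_3$ be an edge incoming at the initial vertex of $e_3$. Then $\tilde E_e=E_e$ for all $e\neq e_1,e_2,e_3$, and $$\tilde E_{e_i}=(-1)^{\mathrm{wind}(\tilde e_i,f_i)-\mathrm{wind}(e_i,f_i)+\mathrm{int}(\tilde e_i)-\mathrm{int}(e_i)}E_{e_i}\quad(i=1,2),\qquad \tilde E_{e_3}=(-1)^{\mathrm{wind}(f_3,\tilde e_3)-\mathrm{wind}(f_3,e_3)}E_{e_3}.$$ (2) Let instead $\tilde{\mathcal N}$ be obtained from $\mathcal N$ by moving one internal trivalent black vertex $V$ with outgoing edge $e_1$ and incoming edges $e_2,e_3$. Let $f_1$ be an edge outgoing at the end vertex of $e_1$ and $f_i$ ($i=2,3$) an edge incoming at the initial vertex of $e_i$. Then $\tilde E_e=E_e$ for all $e\neq e_1,e_2,e_3$, and $$\tilde E_{e_1}=(-1)^{\mathrm{wind}(\tilde e_1,f_1)-\mathrm{wind}(e_1,f_1)+\mathrm{int}(\tilde e_1)-\mathrm{int}(e_1)}E_{e_1},\qquad \tilde E_{e_i}=(-1)^{\mathrm{wind}(f_i,\tilde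 e_i)-\mathrm{wind}(f_i,e_i)}E_{e_i}\quad(i=2,3).$$
   Context: **Plabic networks.** Let $D$ be a closed convex disk whose boundary contains a straight segment. A plabic graph is a finite directed planar graph embedded in $D$ with straight edges. It has boundary vertices $b_1,\dots,b_n$ on the segment, labelled clockwise, each of degree 1 (a source if its edge is outgoing, a sink otherwise). The remaining (internal) vertices lie inside $D$ and have degree 2 or 3. No component is isolated from the boundary. The graph is perfect: each internal vertex has exactly one incoming edge (then it is white) or exactly one outgoing edge (then it is black); bivalent vertices have one incoming and one outgoing edge and either color. The orientation $\mathcal O$ is called a perfect orientation. A network $\mathcal N$ has a positive weight $w_e$ on each directed edge. **Gauge rays.** A gauge ray direction $\mathfrak l$ is an oriented direction, not parallel to any edge, such that the rays with direction $\mathfrak l$ starting at boundary vertices point inside $D$ and contain no internal vertices. The gauge rays are those starting at the boundary sources, and $\mathrm{int}(e)$ is the number of their intersections with $e$ (base points not counted). **Winding.** $s(a,b)=+1,0,-1$ if the ordered pair $(a,b)$ is positively oriented, parallel, negatively oriented. For consecutive directed edges: $\mathrm{wind}(e,f)=\pm1$ if $s(e,f)=s(e,\mathfrak l)=s(\mathfrak l,f)=\pm1$; otherwise $0$. **Edge vectors.** The edge vectors are the unique solution of $E_e=(-1)^{\mathrm{int}(e)}w_e\sum_f(-1)^{\mathrm{wind}(e,f)}E_f$ (for every edge $e$ ending at an internal vertex $V$, $f$ running over the edges outgoing at $V$), with $E_{e_j}=(-1)^{\mathrm{int}(e_j)}w_{e_j}E_j$ at the edge $e_j$ ending at the sink $b_j$,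 $E_j$ being the $j$-th canonical basis vector of $\mathbb R^n$. **Vertex gauge transformation.** A single internal vertex $V$ is moved continuously to a new position, all other vertices staying fixed, the graph remaining a straight-edge planar embedding throughout (the relative positions in the graph do not change) and the weights being unchanged. The direction $\mathfrak l$ is a gauge ray direction for both the initial and the final graph. If an edge $f_i$ does not exist because $e_i$ ends at a boundary sink or starts at a boundary source, the corresponding winding terms are omitted. *)

theory Defs
  imports "HOL-Analysis.Analysis" "Graph_Theory.Digraph"
begin

datatype colour = White | Black

text \<open>
  The plane is \<^typ>\<open>complex\<close>. The index type \<open>'n\<close>, a finite linearly ordered type, plays the role of
  \<open>{1..n}\<close>: \<open>boundary j\<close> is the \<open>j\<close>-th boundary vertex and edge vectors live in \<open>real ^ 'n\<close>.
  The colour is part of the data because a bivalent vertex may have either one.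
\<close>

record ('v, 'e, 'n) network =
  graph :: "('v, 'e) pre_digraph"
  boundary :: "'n \<Rightarrow> 'v"
  colour :: "'v \<Rightarrow> colour"
  pos :: "'v \<Rightarrow> complex"
  weight :: "'e \<Rightarrow> real"

definition internal :: "('v, 'e, 'n) network \<Rightarrow> 'v set" where
  "internal N = verts (graph N) - range (boundary N)"

definition degree :: "('v, 'e, 'n) network \<Rightarrow> 'v \<Rightarrow> nat" where
  "degree N v = in_degree (graph N) v + out_degree (graph N) v"

definition is_source :: "('v, 'e, 'n) network \<Rightarrow> 'n \<Rightarrow> bool" where
  "is_source N j \<longleftrightarrow> out_arcs (graph N) (boundary N j) \<noteq> {}"

definition edge_dir :: "('v, 'e, 'n) network \<Rightarrow> 'e \<Rightarrow> complex" where
  "edge_dir N e = pos N (head (graph N) e) - pos N (tail (graph N) e)"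

definition edge_segment :: "('v, 'e, 'n) network \<Rightarrow> 'e \<Rightarrow> complex set" where
  "edge_segment N e = closed_segment (pos N (tail (graph N) e)) (pos N (head (graph N) e))"

definition open_edge :: "('v, 'e, 'n) network \<Rightarrow> 'e \<Rightarrow> complex set" where
  "open_edge N e = open_segment (pos N (tail (graph N) e)) (pos N (head (graph N) e))"

definition cross :: "complex \<Rightarrow> complex \<Rightarrow> real" where
  "cross a b = Re a * Im b - Im a * Re b"

definition disk_with_segment :: "complex set \<Rightarrow> complex set \<Rightarrow> bool" where
  "disk_with_segment D S \<longleftrightarrow> compact D \<and> convex D \<and> interior D \<noteq> {} \<and>
     S \<subseteq> frontier D \<and> (\<exists>p q. p \<noteq> q \<and> S = closed_segment p q)"

text \<open>
  Walking along the frontier of \<open>D\<close> clockwise keeps the interior of \<open>D\<close> on the right; for boundary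
  vertices on the segment \<open>S\<close> this is \<open>boundary_clockwise\<close>. Edges lie in \<open>D\<close> automatically, as \<open>D\<close> is
  convex.
\<close>

locale plabic_network =
  fixes D S :: "complex set"
    and N :: "('v, 'e, 'n::{finite,linorder}) network"
  assumes disk: "disk_with_segment D S"
    and digraph: "digraph (graph N)"
    and boundary_inj: "inj (boundary N)"
    and boundary_verts: "range (boundary N) \<subseteq> verts (graph N)"
    and boundary_degree: "degree N (boundary N j) = 1"
    and boundary_on_segment: "pos N (boundary N j) \<in> S"
    and boundary_clockwise: "\<lbrakk>i < j; z \<in> interior D\<rbrakk> \<Longrightarrow>
      cross (pos N (boundary N j) - pos N (boundary N i)) (z - pos N (boundary N i)) < 0"
    and internal_inside: "v \<in> internal N \<Longrightarrow> pos N v \<in> interior D"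
    and internal_degree: "v \<in> internal N \<Longrightarrow> degree N v \<in> {2, 3}"
    and white: "\<lbrakk>v \<in> internal N; colour N v = White\<rbrakk> \<Longrightarrow> in_degree (graph N) v = 1"
    and black: "\<lbrakk>v \<in> internal N; colour N v = Black\<rbrakk> \<Longrightarrow> out_degree (graph N) v = 1"
    and not_isolated: "v \<in> verts (graph N) \<Longrightarrow>
      \<exists>j. (boundary N j, v) \<in> (arcs_ends (graph N) \<union> (arcs_ends (graph N))\<inverse>)\<^sup>*"
    and pos_inj: "inj_on (pos N) (verts (graph N))"
    and no_vertex_on_edge: "\<lbrakk>v \<in> verts (graph N); e \<in> arcs (graph N)\<rbrakk> \<Longrightarrow> pos N v \<notin> open_edge N e"
    and no_edge_crossing: "\<lbrakk>e \<in> arcs (graph N); f \<in> arcs (graph N); e \<noteq> f\<rbrakk> \<Longrightarrow>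
      open_edge N e \<inter> open_edge N f = {}"
    and weight_pos: "e \<in> arcs (graph N) \<Longrightarrow> weight N e > 0"

definition gauge_direction :: "complex set \<Rightarrow> ('v, 'e, 'n) network \<Rightarrow> complex \<Rightarrow> bool" where
  "gauge_direction D N l \<longleftrightarrow> l \<noteq> 0 \<and>
     (\<forall>e\<in>arcs (graph N). cross l (edge_dir N e) \<noteq> 0) \<and>
     (\<forall>j. \<exists>\<epsilon>>0. \<forall>t::real. 0 < t \<and> t < \<epsilon> \<longrightarrow> pos N (boundary N j) + t *\<^sub>R l \<in> interior D) \<and>
     (\<forall>j. \<forall>v\<in>internal N. \<forall>t::real. t \<ge> 0 \<longrightarrow> pos N v \<noteq> pos N (boundary N j) + t *\<^sub>R l)"

text \<open>
  The number \<open>int(e)\<close>: each intersection is recorded as the source index \<open>j\<close> together with the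
  parameter \<open>t\<close> on its ray; \<open>t > 0\<close> leaves out the base point.
\<close>

definition ray_crossings :: "('v, 'e, 'n) network \<Rightarrow> complex \<Rightarrow> 'e \<Rightarrow> nat" where
  "ray_crossings N l e =
     card {(j, t::real). is_source N j \<and> t > 0 \<and> pos N (boundary N j) + t *\<^sub>R l \<in> edge_segment N e}"

definition orient :: "complex \<Rightarrow> complex \<Rightarrow> int" where
  "orient a b = (if cross a b > 0 then 1 else if cross a b < 0 then -1 else 0)"

definition wind :: "('v, 'e, 'n) network \<Rightarrow> complex \<Rightarrow> 'e \<Rightarrow> 'e \<Rightarrow> int" where
  "wind N l e f =
     (let a = edge_dir N e; b = edge_dir N f
      in if orient a b = orient a l \<and> orient a l = orient l b then orient a b else 0)"

definition solves_edge_system ::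
    "('v, 'e, 'n::finite) network \<Rightarrow> complex \<Rightarrow> ('e \<Rightarrow> real ^ 'n) \<Rightarrow> bool" where
  "solves_edge_system N l E \<longleftrightarrow>
     (\<forall>e\<in>arcs (graph N). head (graph N) e \<in> internal N \<longrightarrow>
        E e = ((-1) ^ ray_crossings N l e * weight N e) *\<^sub>R
          (\<Sum>f\<in>out_arcs (graph N) (head (graph N) e). ((-1) powi wind N l e f) *\<^sub>R E f)) \<and>
     (\<forall>j. \<forall>e\<in>in_arcs (graph N) (boundary N j).
        E e = ((-1) ^ ray_crossings N l e * weight N e) *\<^sub>R axis j 1)"

text \<open>\<open>E\<close> is the unique solution; its values outside the edge set are irrelevant.\<close>

definition edge_vectors ::
    "('v, 'e, 'n::finite) network \<Rightarrow> complex \<Rightarrow> ('e \<Rightarrow> real ^ 'n) \<Rightarrow> bool" where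
  "edge_vectors N l E \<longleftrightarrow> solves_edge_system N l E \<and>
     (\<forall>F. solves_edge_system N l F \<longrightarrow> (\<forall>e\<in>arcs (graph N). F e = E e))"

definition place :: "('v, 'e, 'n) network \<Rightarrow> 'v \<Rightarrow> complex \<Rightarrow> ('v, 'e, 'n) network" where
  "place N V z = N\<lparr>pos := (pos N)(V := z)\<rparr>"

definition vertex_gauge_move ::
    "complex set \<Rightarrow> complex set \<Rightarrow> ('v, 'e, 'n::{finite,linorder}) network \<Rightarrow> 'v \<Rightarrow>
     ('v, 'e, 'n) network \<Rightarrow> bool" where
  "vertex_gauge_move D S N V N' \<longleftrightarrow> V \<in> internal N \<and>
     (\<exists>\<gamma>. path \<gamma> \<and> pathstart \<gamma> = pos N V \<and> N' = place N V (pathfinish \<gamma>) \<and>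
        (\<forall>t\<in>{0..1}. plabic_network D S (place N V (\<gamma> t))))"

end

theory Submission
  imports Defs
begin

text \<open>
  The candidate solution on the moved network is \<open>E\<close> with signs inserted at the edges incident to \<open>V\<close>;
  uniqueness of the edge vectors then identifies it with \<open>E'\<close>. To verify the system, lift the
  direction of each edge along the move to a continuous angle measured from \<open>l\<close>, and let the
  \<open>twist\<close> of the edge be the parity of its net number of passages through direction \<open>l\<close>.
  Consecutive edges of a planar straight-edge network are never antiparallel, so \<open>wind(e,f)\<close> changes
  parity exactly by the product of the twists of \<open>e\<close> and \<open>f\<close>. The parity of \<open>int(e)\<close> is a product, over
  the sources other than the initial vertex of \<open>e\<close>, of the signs telling whether the gauge line
  separates the ends of \<open>e\<close>; hence it changes by the same factor for all edges at \<open>V\<close>, except for an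
  edge leaving a boundary source, where its twist appears as an extra factor.
\<close>

section \<open>Lifted angles and the winding of two directions\<close>

definition turn :: "real \<Rightarrow> int" where
  "turn \<theta> = \<lfloor>\<theta> / (2 * pi)\<rfloor>"

lemma cross_polar:
  "cross (l * (of_real r * cis \<alpha>)) (l * (of_real s * cis \<beta>)) = (cmod l)\<^sup>2 * r * s * sin (\<beta> - \<alpha>)"
  unfolding cross_def cmod_power2 sin_diff
  by (simp add: algebra_simps power2_eq_square)

lemma orient_polar:
  assumes "l \<noteq> 0" "r > 0" "s > 0"
  shows "orient (l * (of_real r * cis \<alpha>)) (l * (of_real s * cis \<beta>)) =
    (if sin (\<beta> - \<alpha>) > 0 then 1 else if sin (\<beta> - \<alpha>) < 0 then -1 else 0)"
  unfolding orient_def cross_polar using assms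
  by (simp add: zero_less_mult_iff mult_less_0_iff)

lemma sin_shift_2pi_int: "sin (x + 2 * pi * of_int m) = sin x" for x :: real
  using sin_cos_eq_iff[of "x + 2 * pi * of_int m" x] by (auto intro!: exI[of _ m])

lemma turn_remainder:
  obtains \<rho> where "\<theta> = \<rho> + 2 * pi * of_int (turn \<theta>)" "0 \<le> \<rho>" "\<rho> < 2 * pi" "sin \<rho> = sin \<theta>"
proof
  let ?r = "\<theta> - 2 * pi * of_int (turn \<theta>)"
  show "\<theta> = ?r + 2 * pi * of_int (turn \<theta>)" by simp
  have "of_int (turn \<theta>) \<le> \<theta> / (2 * pi)" "\<theta> / (2 * pi) < of_int (turn \<theta>) + 1"
    unfolding turn_def by linarith+
  then show "0 \<le> ?r" "?r < 2 * pi" by (auto simp: field_simps)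
  show "sin ?r = sin \<theta>"
    using sin_shift_2pi_int[of ?r "turn \<theta>"] by simp
qed

lemma turn_unique:
  assumes "2 * pi * of_int k \<le> \<theta>" "\<theta> < 2 * pi * of_int k + 2 * pi"
  shows "turn \<theta> = k"
  unfolding turn_def using assms by (intro floor_unique) (auto simp: field_simps)

lemma sin_sign_two_pi:
  assumes "0 \<le> x" "x < 2 * pi" "sin x \<noteq> 0"
  shows "(sin x > 0 \<and> 0 < x \<and> x < pi) \<or> (sin x < 0 \<and> pi < x)"
proof -
  have "x \<noteq> 0" "x \<noteq> pi" using assms by auto
  then consider "0 < x \<and> x < pi" | "pi < x" using assms by linarith
  then show ?thesis
    using sin_gt_zero sin_lt_zero assms by cases auto
qed

text \<open>Both sides count, with sign, the multiples of \<open>2 \<pi>\<close>, the arguments of \<open>l\<close>, passed on the short way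
  from \<open>a\<close> to \<open>b\<close>.\<close>

lemma winding_eq_turn:
  assumes l: "l \<noteq> 0" and a: "a = l * (of_real r * cis \<alpha>)" and r: "r > 0"
    and b: "b = l * (of_real s * cis \<beta>)" and s: "s > 0"
    and la: "cross l a \<noteq> 0" and lb: "cross l b \<noteq> 0"
    and k: "\<bar>\<beta> - \<alpha> - 2 * pi * of_int k\<bar> < pi"
  shows "(if orient a b = orient a l \<and> orient a l = orient l b then orient a b else 0)
    = turn \<beta> - turn \<alpha> - k"
proof -
  have l1: "l = l * (of_real 1 * cis 0)" by simp
  have o: "orient a b = (if sin (\<beta> - \<alpha>) > 0 then 1 else if sin (\<beta> - \<alpha>) < 0 then -1 else 0)"
    "orient a l = (if sin \<alpha> < 0 then 1 else if sin \<alpha> > 0 then -1 else 0)"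
    "orient l b = (if sin \<beta> > 0 then 1 else if sin \<beta> < 0 then -1 else 0)"
    using orient_polar[OF l r s, of \<alpha> \<beta>] orient_polar[OF l r, of 1 \<alpha> 0]
      orient_polar[OF l _ s, of 1 0 \<beta>] by (simp_all add: a b)
  obtain \<alpha>0 where \<alpha>0: "\<alpha> = \<alpha>0 + 2 * pi * of_int (turn \<alpha>)" "0 \<le> \<alpha>0" "\<alpha>0 < 2 * pi" "sin \<alpha>0 = sin \<alpha>"
    by (rule turn_remainder)
  obtain \<beta>0 where \<beta>0: "\<beta> = \<beta>0 + 2 * pi * of_int (turn \<beta>)" "0 \<le> \<beta>0" "\<beta>0 < 2 * pi" "sin \<beta>0 = sin \<beta>"
    by (rule turn_remainder)
  \<comment> \<open>Neither direction is parallel to \<open>l\<close>, so both remainders avoid 0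
    and \<open>pi\<close>, and their sines tell in which half of the period they lie.\<close>
  have "sin \<alpha>0 \<noteq> 0" "sin \<beta>0 \<noteq> 0"
    using la lb cross_polar[of l 1 0 r \<alpha>] cross_polar[of l 1 0 s \<beta>] \<alpha>0(4) \<beta>0(4) by (auto simp: a b)
  note sa = sin_sign_two_pi[OF \<alpha>0(2,3) this(1)] and sb = sin_sign_two_pi[OF \<beta>0(2,3) this(2)]
  define m where "m = turn \<beta> - turn \<alpha> - k"
  define \<delta> where "\<delta> = \<beta>0 - \<alpha>0 + 2 * pi * of_int m"
  have \<delta>_eq: "\<delta> = \<beta> - \<alpha> - 2 * pi * of_int k"
    by (subst \<alpha>0(1), subst \<beta>0(1)) (simp add: \<delta>_def m_def algebra_simps)
  have \<delta>: "-pi < \<delta>" "\<delta> < pi" using k unfolding \<delta>_eq by linarith+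
  have sd: "sin (\<beta> - \<alpha>) = sin \<delta>"
    using sin_shift_2pi_int[of \<delta> k] unfolding \<delta>_eq by simp
  have s\<delta>: "(\<delta> > 0 \<longrightarrow> sin \<delta> > 0) \<and> (\<delta> < 0 \<longrightarrow> sin \<delta> < 0) \<and> (\<delta> = 0 \<longrightarrow> sin \<delta> = 0)"
    using sin_gt_zero[of \<delta>] sin_gt_zero[of "-\<delta>"] \<delta> by auto
  have "2 * pi * of_int m < 2 * pi * 2" "2 * pi * of_int m > 2 * pi * (-2)"
    using \<delta> \<alpha>0(2,3) \<beta>0(2,3) pi_gt_zero unfolding \<delta>_def by linarith+
  then have "of_int m < (2::real)" "of_int m > (-2::real)"
    using mult_less_cancel_left_pos[of "2 * pi" "of_int m" 2]
      mult_less_cancel_left_pos[of "2 * pi" "-2" "of_int m"] pi_gt_zero by linarith+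
  \<comment> \<open>If \<open>m\<close> is 1, the bound on \<open>\<delta>\<close> forces
    \<open>\<alpha>0\<close> above \<open>pi\<close> and \<open>\<beta>0\<close> below it, so the
    short way from \<open>a\<close> to \<open>b\<close> passes \<open>l\<close> counterclockwise; -1
    is the mirror image. If \<open>m\<close> is 0, the three orientations cannot agree.\<close>
  then have "m = -1 \<or> m = 0 \<or> m = 1" by linarith
  then show ?thesis
    unfolding o sd m_def[symmetric]
    using sa sb s\<delta> \<alpha>0(2-4) \<beta>0(2-4) \<delta> unfolding \<delta>_def
    by (elim disjE conjE) (auto split: if_splits)
qed

section \<open>Continuous angles along a path of directions\<close>

text \<open>By the intermediate value theorem \<open>h\<close> cannot leave the period containing
  \<open>h 0\<close> without hitting one of its ends. It serves with \<open>c = 0\<close>, to avoid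
  the direction of \<open>l\<close>, and with \<open>c = -pi\<close>, to avoid opposite
  directions.\<close>

lemma continuous_in_period:
  fixes h :: "real \<Rightarrow> real"
  assumes cont: "continuous_on {0..1} h"
    and avoid: "\<And>t k. t \<in> {0..1} \<Longrightarrow> h t \<noteq> c + 2 * pi * of_int k"
  obtains k :: int where
    "\<And>t. t \<in> {0..1} \<Longrightarrow> c + 2 * pi * of_int k < h t \<and> h t < c + 2 * pi * of_int k + 2 * pi"
proof
  let ?k = "turn (h 0 - c)"
  let ?a = "c + 2 * pi * of_int ?k" and ?b = "c + 2 * pi * of_int ?k + 2 * pi"
  have b: "?b = c + 2 * pi * of_int (?k + 1)" by (simp add: algebra_simps)
  fix t :: real assume t: "t \<in> {0..1}"
  obtain \<rho> where "h 0 - c = \<rho> + 2 * pi * of_int ?k" "0 \<le> \<rho>" "\<rho> < 2 * pi"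
    by (rule turn_remainder)
  then have h0: "?a \<le> h 0" "h 0 \<le> ?b" by auto
  have c': "continuous_on {0..t} h" using cont t by (auto intro: continuous_on_subset)
  show "?a < h t \<and> h t < ?b"
  proof (rule ccontr)
    assume "\<not> ?thesis"
    then consider "h t \<le> ?a" | "?b \<le> h t" by linarith
    then obtain x where "x \<in> {0..1}" "h x = ?a \<or> h x = ?b"
    proof cases
      case 1
      then show ?thesis using IVT2'[of h t ?a 0] h0 c' t that by fastforce
    next
      case 2
      then show ?thesis using IVT'[of h 0 ?b t] h0 c' t that by fastforce
    qed
    then show False using avoid[of x ?k] avoid[of x "?k + 1"] b by auto
  qed
qed

text \<open>Dividing by \<open>l\<close> puts the direction of \<open>l\<close> at the multiples of
  \<open>2 * pi\<close>, exactly where \<open>turn\<close> jumps.\<close>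

definition polar_lift :: "complex \<Rightarrow> (real \<Rightarrow> complex) \<Rightarrow> (real \<Rightarrow> real) \<Rightarrow> bool" where
  "polar_lift l d \<theta> \<longleftrightarrow> continuous_on {0..1} \<theta> \<and>
     (\<forall>t\<in>{0..1}. \<exists>r>0. d t = l * (of_real r * cis (\<theta> t)))"

text \<open>The interval is contractible, so the nonvanishing path \<open>d t / l\<close> has a
  continuous logarithm; its imaginary part is the angle.\<close>

lemma polar_lift_exists:
  assumes "l \<noteq> 0" "continuous_on {0..1} d" "\<And>t. t \<in> {0..1} \<Longrightarrow> d t \<noteq> 0"
  shows "\<exists>\<theta>. polar_lift l d \<theta>"
proof -
  have "continuous_on {0..1} (\<lambda>t. d t / l)" using assms by (intro continuous_intros) auto
  then obtain g where g: "continuous_on {0..1} g" "\<And>t. t \<in> {0..1} \<Longrightarrow> d t / l = exp (g t)"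
    using continuous_logarithm_on_contractible[of "{0..1::real}" "\<lambda>t. d t / l"] assms
    by (auto simp: convex_imp_contractible)
  have "\<exists>r>0. d t = l * (of_real r * cis (Im (g t)))" if "t \<in> {0..1}" for t
    using g(2)[OF that] assms(1)
    by (intro exI[of _ "exp (Re (g t))"]) (simp add: exp_eq_polar field_simps)
  then show ?thesis
    unfolding polar_lift_def using g(1)
    by (intro exI[of _ "\<lambda>t. Im (g t)"]) (auto intro: continuous_intros)
qed

lemma turn_constant:
  assumes \<theta>: "polar_lift l d \<theta>"
    and avoid: "\<And>t c. \<lbrakk>t \<in> {0..1}; c > 0\<rbrakk> \<Longrightarrow> d t \<noteq> c *\<^sub>R l"
  shows "turn (\<theta> 1) = turn (\<theta> 0)"
proof -
  have "\<theta> t \<noteq> 0 + 2 * pi * of_int k" if "t \<in> {0..1}" for t k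
  proof
    assume "\<theta> t = 0 + 2 * pi * of_int k"
    then have "cis (\<theta> t) = 1" using cis_multiple_2pi[of "of_int k"] by simp
    moreover obtain r where "r > 0" "d t = l * (of_real r * cis (\<theta> t))"
      using \<theta> \<open>t \<in> {0..1}\<close> unfolding polar_lift_def by blast
    ultimately show False using avoid[OF that, of r] by (auto simp: scaleR_conv_of_real mult.commute)
  qed
  then obtain k where "\<And>t. t \<in> {0..1} \<Longrightarrow> 0 + 2 * pi * of_int k < \<theta> t \<and> \<theta> t < 0 + 2 * pi * of_int k + 2 * pi"
    using continuous_in_period[of \<theta> 0] \<theta> unfolding polar_lift_def by metis
  from this[of 0] this[of 1] show ?thesis
    using turn_unique[of k "\<theta> 0"] turn_unique[of k "\<theta> 1"] by simp
qed

lemma sgn_cross_polar: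
  assumes "l \<noteq> 0" "r > 0"
  shows "sgn (cross l (l * (of_real r * cis \<alpha>))) = sgn (sin \<alpha>)"
  using cross_polar[of l 1 0 r \<alpha>] assms by (simp add: sgn_mult)

text \<open>A path that never points against \<open>l\<close> keeps its angle within
  \<open>pi\<close> of one multiple \<open>2 * pi * k\<close>. There \<open>turn\<close> is
  \<open>k\<close> to the left of \<open>l\<close> and \<open>k - 1\<close> to the right, so its
  change is odd precisely when the path ends on the other side.\<close>

lemma turn_parity_sgn:
  assumes l: "l \<noteq> 0" and \<theta>: "polar_lift l d \<theta>"
    and avoid: "\<And>t c. \<lbrakk>t \<in> {0..1}; c > 0\<rbrakk> \<Longrightarrow> d t \<noteq> - c *\<^sub>R l"
    and "cross l (d 0) \<noteq> 0" "cross l (d 1) \<noteq> 0"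
  shows "(-1) powi (turn (\<theta> 1) - turn (\<theta> 0)) = sgn (cross l (d 1)) * sgn (cross l (d 0))"
proof -
  have pol: "\<exists>r>0. d t = l * (of_real r * cis (\<theta> t))" if "t \<in> {0..1}" for t
    using \<theta> that unfolding polar_lift_def by blast
  have "\<theta> t \<noteq> -pi + 2 * pi * of_int k" if "t \<in> {0..1}" for t k
  proof
    assume "\<theta> t = -pi + 2 * pi * of_int k"
    then have "cis (\<theta> t) = -1" using minus_cis'[of "2 * pi * of_int k"] cis_multiple_2pi[of "of_int k"]
      by simp
    then show False using pol[OF that] avoid[OF that]
      by (auto simp: scaleR_conv_of_real mult.commute)
  qed
  then obtain k where k: "\<And>t. t \<in> {0..1} \<Longrightarrow>
      -pi + 2 * pi * of_int k < \<theta> t \<and> \<theta> t < -pi + 2 * pi * of_int k + 2 * pi"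
    using continuous_in_period[of \<theta> "-pi"] \<theta> unfolding polar_lift_def by metis
  have *: "sgn (cross l (d t)) = 1 \<and> turn (\<theta> t) = k \<or> sgn (cross l (d t)) = -1 \<and> turn (\<theta> t) = k - 1"
    if t: "t \<in> {0..1}" and nz: "cross l (d t) \<noteq> 0" for t
  proof -
    define x where "x = \<theta> t - 2 * pi * of_int k"
    have x: "-pi < x" "x < pi" using k[OF t] by (auto simp: x_def)
    have "sgn (cross l (d t)) = sgn (sin (\<theta> t))"
      using pol[OF t] sgn_cross_polar[OF l] by auto
    also have "sin (\<theta> t) = sin x" using sin_shift_2pi_int[of x k] by (simp add: x_def)
    finally have sx: "sgn (cross l (d t)) = sgn (sin x)" .
    with nz have "x \<noteq> 0" by (auto simp: sgn_zero_iff)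
    then consider "x > 0" | "x < 0" by linarith
    then show ?thesis
    proof cases
      case 1
      then show ?thesis using sin_gt_zero[of x] x sx turn_unique[of k "\<theta> t"] by (simp add: x_def)
    next
      case 2
      then have "sin x < 0" using sin_gt_zero[of "-x"] x by simp
      then show ?thesis using 2 x sx turn_unique[of "k - 1" "\<theta> t"] by (simp add: x_def algebra_simps)
    qed
  qed
  from *[of 0] *[of 1] assms(4,5) show ?thesis by auto
qed

section \<open>Cross products and rays in a convex set\<close>

lemma cross_scaleR_left [simp]: "cross (c *\<^sub>R a) b = c * cross a b"
  and cross_scaleR_right [simp]: "cross a (c *\<^sub>R b) = c * cross a b"
  and cross_self [simp]: "cross a a = 0"
  and cross_diff_right: "cross a (b - b') = cross a b - cross a b'"
  by (simp_all add: cross_def algebra_simps)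

lemma cross_zero_imp_multiple:
  assumes "l \<noteq> 0" "cross l z = 0"
  obtains s where "z = s *\<^sub>R l"
proof (cases "Re l = 0")
  case True
  then have "Im l \<noteq> 0" using assms(1) by (auto simp: complex_eq_iff)
  with True assms(2) have "z = (Im z / Im l) *\<^sub>R l" by (auto simp: complex_eq_iff cross_def)
  then show ?thesis by (rule that)
next
  case False
  with assms(2) have "z = (Re z / Re l) *\<^sub>R l" by (auto simp: complex_eq_iff cross_def field_simps)
  then show ?thesis by (rule that)
qed

text \<open>Otherwise \<open>b\<close> would lie strictly between an interior point of
  \<open>D\<close> and a point of \<open>D\<close>, and hence be interior itself.\<close>

lemma no_backward_ray:
  fixes b l :: complex
  assumes "convex D" "b \<notin> interior D" "\<epsilon> > 0" "b + \<epsilon> *\<^sub>R l \<in> interior D" "c > 0"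
  shows "b - c *\<^sub>R l \<notin> D"
proof
  assume D: "b - c *\<^sub>R l \<in> D"
  show False
  proof (cases "l = 0")
    case True
    then show False using assms by simp
  next
    case False
    \<comment> \<open>The weight at which the forward displacement \<open>\<epsilon>\<close> and the
      backward displacement \<open>c\<close> balance, so that the convex combination is
      \<open>b\<close>.\<close>
    define u where "u = \<epsilon> / (\<epsilon> + c)"
    have u: "0 < u" "u < 1" "(1 - u) * \<epsilon> = u * c" using assms by (auto simp: u_def field_simps)
    have "(1 - u) *\<^sub>R (b + \<epsilon> *\<^sub>R l) + u *\<^sub>R (b - c *\<^sub>R l) = b + ((1 - u) * \<epsilon> - u * c) *\<^sub>R l"
      by (simp add: algebra_simps)
    then have "b = (1 - u) *\<^sub>R (b + \<epsilon> *\<^sub>R l) + u *\<^sub>R (b - c *\<^sub>R l)" using u by simp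
    moreover have "b + \<epsilon> *\<^sub>R l \<noteq> b - c *\<^sub>R l"
    proof
      assume "b + \<epsilon> *\<^sub>R l = b - c *\<^sub>R l"
      then have "(\<epsilon> + c) *\<^sub>R l = 0" by (simp add: algebra_simps)
      then show False using assms False by simp
    qed
    ultimately have "b \<in> open_segment (b + \<epsilon> *\<^sub>R l) (b - c *\<^sub>R l)"
      using u unfolding in_segment by blast
    then show False
      using in_interior_closure_convex_segment[OF assms(1,4), of "b - c *\<^sub>R l"] D closure_subset assms(2)
      by blast
  qed
qed

section \<open>Consequences of planarity and of the boundary conditions\<close>

context plabic_network
begin

sublocale G: digraph "graph N" by (rule digraph)

lemma convex_D: "convex D" and closed_D: "closed D"
  using disk compact_imp_closed unfolding disk_with_segment_def by auto

lemma boundary_frontier: "pos N (boundary N j) \<in> frontier D"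
  using disk boundary_on_segment unfolding disk_with_segment_def by blast

lemma boundary_not_interior: "pos N (boundary N j) \<notin> interior D"
  using boundary_frontier unfolding frontier_def by blast

lemma verts_cases:
  assumes "v \<in> verts (graph N)"
  obtains "v \<in> internal N" "v \<notin> range (boundary N)" | j where "v = boundary N j" "v \<notin> internal N"
  using assms unfolding internal_def by blast

lemma pos_in_D: "v \<in> verts (graph N) \<Longrightarrow> pos N v \<in> D"
  by (erule verts_cases)
    (use internal_inside interior_subset boundary_frontier closed_D frontier_subset_closed in blast)+

lemma edge_dir_nonzero: "e \<in> arcs (graph N) \<Longrightarrow> edge_dir N e \<noteq> 0"
  using pos_inj G.no_loops G.head_in_verts G.tail_in_verts unfolding edge_dir_def inj_on_def
  by fastforce

text \<open>Antiparallel consecutive edges would leave their common vertex along the same ray and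
  overlap near it, against \<open>no_edge_crossing\<close>.\<close>

lemma consecutive_not_antiparallel:
  assumes e: "e \<in> arcs (graph N)" and f: "f \<in> arcs (graph N)"
    and ef: "head (graph N) e = tail (graph N) f" and c: "c > 0"
  shows "edge_dir N f \<noteq> - c *\<^sub>R edge_dir N e"
proof
  assume A: "edge_dir N f = - c *\<^sub>R edge_dir N e"
  define a v b where "a = pos N (tail (graph N) e)" and "v = pos N (head (graph N) e)"
    and "b = pos N (head (graph N) f)"
  have d: "edge_dir N e = v - a" "edge_dir N f = b - v"
    by (simp_all add: edge_dir_def a_def v_def b_def ef)
  have ne: "v \<noteq> a" "b \<noteq> v" using edge_dir_nonzero[OF e] edge_dir_nonzero[OF f] d by auto
  have b: "b = v - c *\<^sub>R (v - a)" using A d by (simp add: algebra_simps)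
  \<comment> \<open>The point \<open>z\<close> divides \<open>e\<close> at the fraction
    \<open>u\<close> from \<open>v\<close>, and \<open>f\<close> at the fraction
    \<open>u / c\<close>; both fractions are at most one half, so \<open>z\<close> is inside both
    edges.\<close>
  define u where "u = min 1 c / 2"
  have u: "0 < u" "u < 1" "u / c < 1" using c by (auto simp: u_def field_simps)
  define z where "z = v - u *\<^sub>R (v - a)"
  have "z = (1 - (1 - u)) *\<^sub>R a + (1 - u) *\<^sub>R v" by (simp add: z_def algebra_simps)
  with u ne have "z \<in> open_segment a v" unfolding in_segment by (auto intro!: exI[of _ "1 - u"])
  moreover have "z = (1 - u / c) *\<^sub>R v + (u / c) *\<^sub>R b"
    using c by (simp add: z_def b algebra_simps)
  with u c ne have "z \<in> open_segment v b" unfolding in_segment by (auto intro!: exI[of _ "u / c"])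
  ultimately have "z \<in> open_edge N e \<inter> open_edge N f"
    unfolding open_edge_def a_def v_def b_def ef by simp
  moreover have "e \<noteq> f" using G.no_loops[OF e] ef by auto
  ultimately show False using no_edge_crossing[OF e f] by blast
qed

text \<open>A directed 2-cycle would consist of two antiparallel edges. This ensures that an edge
  following or preceding an edge at the moved vertex does not itself return to that vertex.\<close>

lemma no_opposite_edge:
  assumes "e \<in> arcs (graph N)" "f \<in> arcs (graph N)" "head (graph N) e = tail (graph N) f"
  shows "head (graph N) f \<noteq> tail (graph N) e"
  using consecutive_not_antiparallel[OF assms, of 1] assms(3) by (auto simp: edge_dir_def)

lemma no_edge_into_source:
  assumes "is_source N j" "e \<in> arcs (graph N)"
  shows "head (graph N) e \<noteq> boundary N j"
proof
  assume "head (graph N) e = boundary N j"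
  then have "in_arcs (graph N) (boundary N j) \<noteq> {}" using assms(2) by auto
  then have "in_degree (graph N) (boundary N j) > 0" "out_degree (graph N) (boundary N j) > 0"
    using assms(1) unfolding is_source_def in_degree_def out_degree_def
    by (simp_all add: card_gt_0_iff G.finite_in_arcs G.finite_out_arcs del: in_in_arcs_conv)
  then show False using boundary_degree[of j] unfolding degree_def by simp
qed

end

section \<open>Sides of gauge lines and the parity of ray crossings\<close>

definition side :: "('v, 'e, 'n) network \<Rightarrow> complex \<Rightarrow> 'n \<Rightarrow> complex \<Rightarrow> real" where
  "side N l j z = sgn (cross l (z - pos N (boundary N j)))"

locale gauged_network = plabic_network D S N
  for D S :: "complex set" and N :: "('v, 'e, 'n::{finite,linorder}) network" +
  fixes l :: complex
  assumes gauge: "gauge_direction D N l"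
begin

lemma l_nonzero: "l \<noteq> 0" and cross_edge: "e \<in> arcs (graph N) \<Longrightarrow> cross l (edge_dir N e) \<noteq> 0"
  and internal_off_ray: "\<lbrakk>v \<in> internal N; t \<ge> 0\<rbrakk> \<Longrightarrow> pos N v \<noteq> pos N (boundary N j) + t *\<^sub>R l"
  using gauge unfolding gauge_direction_def by blast+

lemma ray_enters:
  obtains \<epsilon> where "\<epsilon> > 0" "\<And>t. \<lbrakk>0 < t; t < \<epsilon>\<rbrakk> \<Longrightarrow> pos N (boundary N j) + t *\<^sub>R l \<in> interior D"
  using gauge unfolding gauge_direction_def by blast

lemma behind_boundary:
  assumes "c > 0"
  shows "pos N (boundary N j) - c *\<^sub>R l \<notin> D"
proof -
  obtain \<epsilon> where "\<epsilon> > 0" "\<And>t. \<lbrakk>0 < t; t < \<epsilon>\<rbrakk> \<Longrightarrow> pos N (boundary N j) + t *\<^sub>R l \<in> interior D"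
    using ray_enters by blast
  then show ?thesis
    using no_backward_ray[OF convex_D boundary_not_interior, of "\<epsilon> / 2" j l c] assms by simp
qed

lemma on_line_imp_on_ray:
  assumes "z \<in> D" "cross l (z - pos N (boundary N j)) = 0"
  obtains t where "t \<ge> 0" "z = pos N (boundary N j) + t *\<^sub>R l"
proof -
  obtain s where s: "z - pos N (boundary N j) = s *\<^sub>R l"
    using cross_zero_imp_multiple l_nonzero assms(2) by blast
  then have z: "z = pos N (boundary N j) + s *\<^sub>R l" by (simp add: algebra_simps)
  then have "s \<ge> 0" using behind_boundary[of "- s" j] assms(1) by force
  then show ?thesis using that z by blast
qed

text \<open>If two boundary vertices shared a line of direction \<open>l\<close>, the interior point
  \<open>z\<close> on that line would make the cross product in \<open>boundary_clockwise\<close>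
  vanish, but it is strictly negative.\<close>

lemma boundary_off_ray:
  assumes "k \<noteq> j"
  shows "pos N (boundary N k) \<noteq> pos N (boundary N j) + t *\<^sub>R l"
proof
  assume A: "pos N (boundary N k) = pos N (boundary N j) + t *\<^sub>R l"
  obtain \<epsilon> where \<epsilon>: "\<epsilon> > 0" "\<And>t. \<lbrakk>0 < t; t < \<epsilon>\<rbrakk> \<Longrightarrow> pos N (boundary N j) + t *\<^sub>R l \<in> interior D"
    using ray_enters by blast
  define z where "z = pos N (boundary N j) + (\<epsilon> / 2) *\<^sub>R l"
  have z: "z \<in> interior D" using \<epsilon> by (simp add: z_def)
  have "z - pos N (boundary N j) = (\<epsilon> / 2) *\<^sub>R l" "z - pos N (boundary N k) = (\<epsilon> / 2 - t) *\<^sub>R l"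
    by (simp_all add: z_def A algebra_simps)
  moreover have "pos N (boundary N k) - pos N (boundary N j) = t *\<^sub>R l"
    "pos N (boundary N j) - pos N (boundary N k) = (- t) *\<^sub>R l" using A by simp_all
  moreover have "j < k \<or> k < j" using assms by auto
  ultimately show False using boundary_clockwise[of j k z] boundary_clockwise[of k j z] z
    by (auto simp del: scaleR_minus_left)
qed

text \<open>The backward half of a gauge line lies outside \<open>D\<close>, so a vertex on the full
  line is on the ray. Thus \<open>side\<close> may be taken with respect to lines while
  \<open>ray_crossings\<close> counts on rays.\<close>

lemma cross_vertex_nonzero:
  assumes "v \<in> verts (graph N)" "v \<noteq> boundary N j"
  shows "cross l (pos N v - pos N (boundary N j)) \<noteq> 0"
proof
  assume "cross l (pos N v - pos N (boundary N j)) = 0"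
  then obtain t where "t \<ge> 0" "pos N v = pos N (boundary N j) + t *\<^sub>R l"
    using on_line_imp_on_ray pos_in_D assms(1) by blast
  then show False
    using assms internal_off_ray boundary_off_ray by (metis verts_cases)
qed

lemma side_square:
  assumes "v \<in> verts (graph N)" "v \<noteq> boundary N j"
  shows "side N l j (pos N v) * side N l j (pos N v) = 1"
  using cross_vertex_nonzero[OF assms] by (simp add: side_def sgn_if)

definition ray_params :: "'e \<Rightarrow> 'n \<Rightarrow> real set" where
  "ray_params e j = {t. t > 0 \<and> pos N (boundary N j) + t *\<^sub>R l \<in> edge_segment N e}"

text \<open>Along \<open>e\<close> the quantity \<open>cross l (z - b)\<close> is affine with end
  values \<open>\<alpha>\<close> and \<open>\<beta>\<close>. It has exactly one zero inside
  \<open>e\<close> if these have opposite signs and none if they have equal signs. If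
  \<open>e\<close> starts at \<open>b\<close>, its only zero is the base point, which is not
  counted.\<close>

lemma ray_params_parity:
  assumes e: "e \<in> arcs (graph N)" and j: "is_source N j"
  shows "finite (ray_params e j) \<and> (-1) ^ card (ray_params e j) =
    (if boundary N j = tail (graph N) e then 1
     else side N l j (pos N (tail (graph N) e)) * side N l j (pos N (head (graph N) e)))"
proof -
  define b p q where "b = pos N (boundary N j)" and "p = pos N (tail (graph N) e)"
    and "q = pos N (head (graph N) e)"
  define \<alpha> \<beta> where "\<alpha> = cross l (p - b)" and "\<beta> = cross l (q - b)"
  have vs: "tail (graph N) e \<in> verts (graph N)" "head (graph N) e \<in> verts (graph N)"
    using e G.head_in_verts G.tail_in_verts by auto
  have \<alpha>\<beta>: "\<beta> - \<alpha> = cross l (edge_dir N e)"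
    by (simp add: \<alpha>_def \<beta>_def edge_dir_def p_def q_def cross_diff_right)
  then have ne: "\<beta> \<noteq> \<alpha>" using cross_edge[OF e] by auto
  have \<beta>0: "\<beta> \<noteq> 0" using cross_vertex_nonzero[OF vs(2)] no_edge_into_source[OF j e]
    by (simp add: \<beta>_def q_def b_def)
  have cross_pt: "cross l ((1 - u) *\<^sub>R p + u *\<^sub>R q - b) = (1 - u) * \<alpha> + u * \<beta>" for u
    by (simp add: \<alpha>_def \<beta>_def cross_def algebra_simps)
  have param: "\<exists>u. 0 \<le> u \<and> u \<le> 1 \<and> b + t *\<^sub>R l = (1 - u) *\<^sub>R p + u *\<^sub>R q \<and> (1 - u) * \<alpha> + u * \<beta> = 0"
    if "t \<in> ray_params e j" for t
  proof -
    have "b + t *\<^sub>R l \<in> closed_segment p q"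
      using that by (simp add: ray_params_def edge_segment_def b_def p_def q_def)
    then obtain u where u: "0 \<le> u" "u \<le> 1" "b + t *\<^sub>R l = (1 - u) *\<^sub>R p + u *\<^sub>R q"
      unfolding in_segment by blast
    have "(1 - u) * \<alpha> + u * \<beta> = cross l (b + t *\<^sub>R l - b)" using cross_pt[of u] u(3) by simp
    also have "\<dots> = 0" by simp
    finally show ?thesis using u by blast
  qed
  show ?thesis
  proof (cases "boundary N j = tail (graph N) e")
    case True
    then have pb: "p = b" "\<alpha> = 0" by (simp_all add: p_def b_def \<alpha>_def cross_def)
    have "ray_params e j = {}"
    proof (rule ccontr)
      assume "ray_params e j \<noteq> {}"
      then obtain t where t: "t \<in> ray_params e j" by blast
      from param[OF t] obtain u where "b + t *\<^sub>R l = (1 - u) *\<^sub>R p + u *\<^sub>R q" "u * \<beta> = 0"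
        using pb by auto
      with \<beta>0 pb have "t *\<^sub>R l = 0" by simp
      then show False using t l_nonzero by (auto simp: ray_params_def)
    qed
    then show ?thesis using True by simp
  next
    case False
    then have \<alpha>0: "\<alpha> \<noteq> 0" using cross_vertex_nonzero[OF vs(1)] by (simp add: \<alpha>_def p_def b_def)
    have sides: "side N l j (pos N (tail (graph N) e)) * side N l j (pos N (head (graph N) e)) = sgn (\<alpha> * \<beta>)"
      by (simp add: side_def \<alpha>_def \<beta>_def p_def q_def b_def sgn_mult)
    show ?thesis
    proof (cases "\<alpha> * \<beta> > 0")
      case True
      have "ray_params e j = {}"
      proof (rule ccontr)
        assume "ray_params e j \<noteq> {}"
        then obtain u where u: "0 \<le> u" "u \<le> 1" "(1 - u) * \<alpha> + u * \<beta> = 0" using param by blast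
        \<comment> \<open>Multiplying by \<open>\<alpha>\<close> makes both summands nonnegative, so
          both vanish.\<close>
        then have "(1 - u) * (\<alpha> * \<alpha>) + u * (\<alpha> * \<beta>) = 0"
          by (metis (no_types, lifting) distrib_left mult.left_commute mult_zero_right)
        moreover have "(1 - u) * (\<alpha> * \<alpha>) \<ge> 0" "u * (\<alpha> * \<beta>) \<ge> 0" using u True by auto
        ultimately have "(1 - u) * (\<alpha> * \<alpha>) = 0" "u * (\<alpha> * \<beta>) = 0" by linarith+
        then show False using \<alpha>0 True by auto
      qed
      then show ?thesis using False True sides by simp
    next
      case neg: False
      then have ab: "\<alpha> * \<beta> < 0" using \<alpha>0 \<beta>0 by (simp add: less_le)
      \<comment> \<open>The zero of the affine function on \<open>e\<close>; opposite signs of the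
        end values place it strictly between 0 and 1.\<close>
      define u where "u = \<alpha> / (\<alpha> - \<beta>)"
      have u0: "(1 - u) * \<alpha> + u * \<beta> = 0" using ne by (simp add: u_def field_simps)
      have u01: "0 < u" "u < 1" using ab by (auto simp: u_def divide_simps mult_less_0_iff)
      define z where "z = (1 - u) *\<^sub>R p + u *\<^sub>R q"
      have "p \<noteq> q" using ne by (auto simp: \<alpha>_def \<beta>_def)
      then have zo: "z \<in> open_segment p q" using u01 unfolding z_def in_segment by blast
      have "z \<in> D"
        using convexD_alt[OF convex_D pos_in_D[OF vs(1)] pos_in_D[OF vs(2)], of u] u01
        by (simp add: z_def p_def q_def)
      moreover have "cross l (z - b) = 0" using cross_pt[of u] u0 by (simp add: z_def)
      ultimately obtain t where t: "t \<ge> 0" "z = b + t *\<^sub>R l"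
        unfolding b_def by (elim on_line_imp_on_ray)
      \<comment> \<open>No vertex lies inside an edge, so the crossing is not the base point and its
        ray parameter is positive.\<close>
      have "z \<noteq> b"
        using no_vertex_on_edge[of "boundary N j" e] zo e boundary_verts
        by (auto simp: open_edge_def b_def p_def q_def)
      then have "t > 0" using t by (cases "t = 0") auto
      have "ray_params e j = {t}"
      proof (intro equalityI subsetI)
        fix s assume "s \<in> ray_params e j"
        from param[OF this] obtain v where v: "b + s *\<^sub>R l = (1 - v) *\<^sub>R p + v *\<^sub>R q" "(1 - v) * \<alpha> + v * \<beta> = 0"
          by blast
        have "(v - u) * (\<beta> - \<alpha>) = 0" using v(2) u0 by (simp add: algebra_simps)
        then have "v = u" using ne by simp
        then have "s *\<^sub>R l = t *\<^sub>R l" using v(1) t(2) by (simp add: z_def)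
        then show "s \<in> {t}" using l_nonzero by simp
      next
        fix s assume "s \<in> {t}"
        then show "s \<in> ray_params e j"
          using \<open>t > 0\<close> zo t(2) open_closed_segment
          by (auto simp: ray_params_def edge_segment_def b_def p_def q_def)
      qed
      then show ?thesis using False sides ab by simp
    qed
  qed
qed

text \<open>The source at the initial vertex of \<open>e\<close> has to be left out of the product:
  its \<open>side\<close> there is 0, whereas its ray contributes the sign 1.\<close>

lemma ray_crossings_parity:
  assumes e: "e \<in> arcs (graph N)"
  shows "(-1) ^ ray_crossings N l e =
    (\<Prod>j\<in>{j. is_source N j \<and> boundary N j \<noteq> tail (graph N) e}.
       side N l j (pos N (tail (graph N) e)) * side N l j (pos N (head (graph N) e)))"
proof -
  let ?J = "{j. is_source N j}"
  have "{(j, t::real). is_source N j \<and> t > 0 \<and> pos N (boundary N j) + t *\<^sub>R l \<in> edge_segment N e} =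
      Sigma ?J (ray_params e)"
    by (auto simp: ray_params_def)
  then have "ray_crossings N l e = (\<Sum>j\<in>?J. card (ray_params e j))"
    unfolding ray_crossings_def using ray_params_parity[OF e] by (simp add: card_SigmaI)
  then have "(-1) ^ ray_crossings N l e = (\<Prod>j\<in>?J. (-1::real) ^ card (ray_params e j))"
    by (simp add: power_sum)
  also have "\<dots> = (\<Prod>j\<in>?J. if boundary N j \<noteq> tail (graph N) e
      then side N l j (pos N (tail (graph N) e)) * side N l j (pos N (head (graph N) e)) else 1)"
    by (rule prod.cong) (use ray_params_parity[OF e] in auto)
  also have "\<dots> = (\<Prod>j\<in>{j\<in>?J. boundary N j \<noteq> tail (graph N) e}.
      side N l j (pos N (tail (graph N) e)) * side N l j (pos N (head (graph N) e)))"
    by (rule prod.inter_filter[symmetric]) simp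
  finally show ?thesis by simp
qed

end

section \<open>Sign arithmetic and repositioning a vertex\<close>

lemma minus_one_powi: "(-1 :: real) powi m = (if even m then 1 else -1)"
  by (cases "even m") (simp_all add: power_int_minus_left_even power_int_minus_left_odd)

lemma place_simps [simp]:
  "graph (place N V z) = graph N" "boundary (place N V z) = boundary N"
  "weight (place N V z) = weight N" "pos (place N V z) = (pos N)(V := z)"
  "internal (place N V z) = internal N" "is_source (place N V z) = is_source N"
  by (simp_all add: place_def internal_def is_source_def fun_eq_iff)

lemma place_same: "place N V (pos N V) = N"
  by (simp add: place_def)

lemma minus_one_powi_diff:
  "(-1 :: real) powi (a - b + int m - int n) = ((-1) powi a * (-1) powi b) * ((-1) ^ m * (-1) ^ n)"
  "(-1 :: real) powi (a - b) = (-1) powi a * (-1) powi b"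
  "(-1 :: real) powi (int m - int n) = (-1) ^ m * (-1) ^ n"
  by (simp_all add: minus_one_powi minus_one_power_iff)

lemma minus_one_square [simp]:
  "(-1 :: real) powi a * (-1) powi a = 1" "(-1 :: real) powi a * ((-1) powi a * x) = x"
  "(-1 :: real) ^ m * (-1) ^ m = 1" "(-1 :: real) ^ m * ((-1) ^ m * x) = x"
  by (simp_all add: minus_one_powi minus_one_power_iff)

lemma minus_one_power_cancel: "(-1 :: real) ^ m * x = y \<Longrightarrow> x = (-1) ^ m * y"
  by auto

text \<open>In the application \<open>k\<close> is the same at both ends of the move, so it cancels
  and only the changes of the two turns remain.\<close>

lemma minus_one_powi_telescope:
  "(-1 :: real) powi (b' - a' - k) = (-1) powi (b - a - k) * ((-1) powi (a' - a) * (-1) powi (b' - b))"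
  by (cases "even a"; cases "even a'"; cases "even b"; cases "even b'"; cases "even k")
    (simp_all add: minus_one_powi)

section \<open>The move of \<open>V\<close> and the twists of the edges\<close>

locale vertex_move =
  fixes D S :: "complex set" and N :: "('v, 'e, 'n::{finite,linorder}) network"
    and V :: 'v and \<gamma> :: "real \<Rightarrow> complex" and l :: complex
  assumes path: "path \<gamma>" and start: "\<gamma> 0 = pos N V" and V: "V \<in> internal N"
    and planar: "t \<in> {0..1} \<Longrightarrow> plabic_network D S (place N V (\<gamma> t))"
    and gauge_start: "gauge_direction D N l"
    and gauge_end: "gauge_direction D (place N V (\<gamma> 1)) l"
begin

abbreviation moved :: "real \<Rightarrow> ('v, 'e, 'n) network" where
  "moved t \<equiv> place N V (\<gamma> t)"

lemma moved_0: "moved 0 = N"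
  using start place_same by metis

text \<open>The gauge condition holds at the two ends of the move; in between, planarity is all that
  is known, so edges may become parallel to \<open>l\<close> and \<open>V\<close> may cross
  rays.\<close>

sublocale M0: gauged_network D S N l
  using planar[of 0] gauge_start moved_0 by (simp add: gauged_network_def gauged_network_axioms_def)

sublocale M1: gauged_network D S "moved 1" l
  using planar[of 1] gauge_end by (simp add: gauged_network_def gauged_network_axioms_def)

lemma V_not_boundary: "V \<noteq> boundary N j"
  using V by (auto simp: internal_def)

lemma V_not_in_range: "V \<notin> range (boundary N)"
  using V by (simp add: internal_def)

lemma V_vertex: "V \<in> verts (graph N)"
  using V by (simp add: internal_def)

lemma position_in_D: "t \<in> {0..1} \<Longrightarrow> \<gamma> t \<in> D"
  using plabic_network.pos_in_D[OF planar, of t V] V_vertex by simp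

definition dir :: "'e \<Rightarrow> real \<Rightarrow> complex" where
  "dir e t = edge_dir (moved t) e"

lemma continuous_dir: "continuous_on {0..1} (dir e)"
  using path unfolding dir_def edge_dir_def path_def
  by (cases "head (graph N) e = V"; cases "tail (graph N) e = V") (auto intro!: continuous_intros)

text \<open>Two lifts of the same direction differ by a constant multiple of \<open>2 * pi\<close>,
  so the choice does not affect \<open>twist\<close>.\<close>

definition angle :: "'e \<Rightarrow> real \<Rightarrow> real" where
  "angle e = (SOME \<theta>. polar_lift l (dir e) \<theta>)"

lemma polar_lift_angle: "e \<in> arcs (graph N) \<Longrightarrow> polar_lift l (dir e) (angle e)"
  unfolding angle_def
  by (rule someI_ex[of "polar_lift l (dir e)"], rule polar_lift_exists[OF M0.l_nonzero continuous_dir])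
    (simp add: dir_def plabic_network.edge_dir_nonzero[OF planar])

definition twist :: "'e \<Rightarrow> real" where
  "twist e = (-1) powi (turn (angle e 1) - turn (angle e 0))"

lemma twist_square [simp]: "twist e * twist e = 1" "twist e * (twist e * x) = x"
  by (simp_all add: twist_def minus_one_powi)

lemma twist_eq_1:
  assumes "e \<in> arcs (graph N)" "\<And>t c. \<lbrakk>t \<in> {0..1}; c > 0\<rbrakk> \<Longrightarrow> dir e t \<noteq> c *\<^sub>R l"
  shows "twist e = 1"
  using turn_constant[OF polar_lift_angle[OF assms(1)] assms(2)] by (simp add: twist_def)

lemma twist_nonincident:
  assumes "e \<in> arcs (graph N)" "tail (graph N) e \<noteq> V" "head (graph N) e \<noteq> V"
  shows "twist e = 1"
proof (rule twist_eq_1[OF assms(1)])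
  have "dir e t = edge_dir N e" for t using assms by (simp add: dir_def edge_dir_def)
  then show "dir e t \<noteq> c *\<^sub>R l" for t c using M0.cross_edge[OF assms(1)] by auto
qed

text \<open>An edge from \<open>V\<close> to a sink pointing along \<open>l\<close> would put
  \<open>V\<close> behind the boundary vertex, outside \<open>D\<close>; hence its direction never
  passes \<open>l\<close>.\<close>

lemma twist_into_sink:
  assumes "e \<in> arcs (graph N)" "tail (graph N) e = V" "head (graph N) e = boundary N j"
  shows "twist e = 1"
proof (rule twist_eq_1[OF assms(1)])
  fix t c :: real assume t: "t \<in> {0..1}" and c: "c > 0"
  have d: "dir e t = pos N (boundary N j) - \<gamma> t"
    using assms V_not_boundary[of j] by (simp add: dir_def edge_dir_def)
  show "dir e t \<noteq> c *\<^sub>R l"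
  proof
    assume "dir e t = c *\<^sub>R l"
    then have "\<gamma> t = pos N (boundary N j) - c *\<^sub>R l" using d by (simp add: algebra_simps)
    then show False using M0.behind_boundary[OF c, of j] position_in_D[OF t] by simp
  qed
qed

text \<open>For the same reason an edge from a source to \<open>V\<close> never points against
  \<open>l\<close>, so \<open>turn_parity_sgn\<close> reduces its twist to whether \<open>V\<close>
  changes sides of that gauge line.\<close>

lemma twist_out_of_source:
  assumes "e \<in> arcs (graph N)" "tail (graph N) e = boundary N j" "head (graph N) e = V"
  shows "twist e = side N l j (\<gamma> 1) * side N l j (\<gamma> 0)"
proof -
  have d: "dir e t = \<gamma> t - pos N (boundary N j)" for t
    using assms V_not_boundary[of j] by (simp add: dir_def edge_dir_def)
  have "dir e t \<noteq> - c *\<^sub>R l" if t: "t \<in> {0..1}" and c: "c > 0" for t c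
  proof
    assume "dir e t = - c *\<^sub>R l"
    then have "\<gamma> t = pos N (boundary N j) - c *\<^sub>R l" using d[of t] by (simp add: algebra_simps)
    then show False using M0.behind_boundary[OF c, of j] position_in_D[OF t] by simp
  qed
  moreover have "cross l (dir e 0) \<noteq> 0" "cross l (dir e 1) \<noteq> 0"
    using M0.cross_edge M1.cross_edge assms(1) by (simp_all add: dir_def moved_0)
  ultimately show ?thesis
    using turn_parity_sgn[OF M0.l_nonzero polar_lift_angle[OF assms(1)]]
    by (simp add: twist_def side_def d)
qed

text \<open>Along the move two consecutive edges are never antiparallel, so the difference of their
  angles stays within one period, and the windings at both ends of the move differ only by the
  numbers of times the two edges pass the gauge direction.\<close>

lemma wind_parity:
  assumes e: "e \<in> arcs (graph N)" and f: "f \<in> arcs (graph N)"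
    and ef: "head (graph N) e = tail (graph N) f"
  shows "(-1) powi wind (moved 1) l e f = (-1) powi wind N l e f * (twist e * twist f)"
proof -
  have pe: "\<exists>r>0. dir e t = l * (of_real r * cis (angle e t))"
    and pf: "\<exists>r>0. dir f t = l * (of_real r * cis (angle f t))" if "t \<in> {0..1}" for t
    using that polar_lift_angle[OF e] polar_lift_angle[OF f] unfolding polar_lift_def by blast+
  have "continuous_on {0..1} (\<lambda>t. angle f t - angle e t)"
    using polar_lift_angle[OF e] polar_lift_angle[OF f] unfolding polar_lift_def
    by (intro continuous_intros) auto
  moreover have "angle f t - angle e t \<noteq> -pi + 2 * pi * of_int k" if t: "t \<in> {0..1}" for t k
  proof
    assume "angle f t - angle e t = -pi + 2 * pi * of_int k"
    then have "angle f t = angle e t - pi + 2 * pi * of_int k" by simp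
    then have cf: "cis (angle f t) = - cis (angle e t)"
      using cis_mult[of "angle e t - pi" "2 * pi * of_int k"] cis_multiple_2pi[of "of_int k"]
        minus_cis'[of "angle e t"] by simp
    obtain r s where rs: "r > 0" "dir e t = l * (of_real r * cis (angle e t))"
        "s > 0" "dir f t = l * (of_real s * cis (angle f t))"
      using pe[OF t] pf[OF t] by blast
    then have "dir f t = - (s / r) *\<^sub>R dir e t" by (simp add: cf scaleR_conv_of_real)
    then show False
      using plabic_network.consecutive_not_antiparallel[OF planar[OF t], of e f "s / r"] rs e f ef
      by (simp add: dir_def)
  qed
  ultimately obtain k where k: "\<And>t. t \<in> {0..1} \<Longrightarrow>
      -pi + 2 * pi * of_int k < angle f t - angle e t \<and>
      angle f t - angle e t < -pi + 2 * pi * of_int k + 2 * pi"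
    using continuous_in_period[of "\<lambda>t. angle f t - angle e t" "-pi"] by blast
  \<comment> \<open>The integer \<open>k\<close> does not depend on \<open>t\<close>, so the same
    formula for the winding applies at both ends of the move, where the gauge condition rules out
    edges parallel to \<open>l\<close>.\<close>
  have w: "wind (moved t) l e f = turn (angle f t) - turn (angle e t) - k"
    if t: "t \<in> {0..1}" and "cross l (dir e t) \<noteq> 0" "cross l (dir f t) \<noteq> 0" for t
  proof -
    obtain r s where rs: "r > 0" "dir e t = l * (of_real r * cis (angle e t))"
        "s > 0" "dir f t = l * (of_real s * cis (angle f t))"
      using pe[OF t] pf[OF t] by blast
    have "\<bar>angle f t - angle e t - 2 * pi * of_int k\<bar> < pi" using k[OF t] by linarith
    from winding_eq_turn[OF M0.l_nonzero rs(2,1) rs(4,3) that(2,3) this]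
    show ?thesis unfolding wind_def Let_def dir_def[symmetric] .
  qed
  have "wind N l e f = turn (angle f 0) - turn (angle e 0) - k"
    "wind (moved 1) l e f = turn (angle f 1) - turn (angle e 1) - k"
    using w[of 0] w[of 1] M0.cross_edge M1.cross_edge e f by (simp_all add: dir_def moved_0)
  then show ?thesis unfolding twist_def by (simp only: minus_one_powi_telescope)
qed

section \<open>Change of the crossing parity under the move\<close>

definition flip :: real where
  "flip = (\<Prod>j | is_source N j. side N l j (\<gamma> 1) * side N l j (\<gamma> 0))"

lemma side_moved [simp]: "side (moved t) l j z = side N l j z"
  using V_not_boundary[of j] by (simp add: side_def)

lemma side_V_square: "side N l j (\<gamma> 0) * side N l j (\<gamma> 0) = 1" "side N l j (\<gamma> 1) * side N l j (\<gamma> 1) = 1"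
  using M0.side_square[of V j] M1.side_square[of V j] V_vertex V_not_boundary[of j]
  by (simp_all add: start)

lemma side_V_product_square:
  "side N l j (\<gamma> 1) * side N l j (\<gamma> 0) * (side N l j (\<gamma> 1) * side N l j (\<gamma> 0)) = 1"
  using side_V_square[of j] by (metis (no_types, lifting) mult.assoc mult.commute mult.right_neutral)

lemma flip_square [simp]: "flip * flip = 1" "flip * (flip * x) = x"
proof -
  show 1: "flip * flip = 1"
    unfolding flip_def prod.distrib[symmetric] by (simp only: side_V_product_square prod.neutral_const)
  show "flip * (flip * x) = x" by (simp add: mult.assoc[symmetric] 1)
qed

text \<open>Comparing the two products source by source, the side of the end of \<open>e\<close>
  that stays fixed cancels and the change of side of \<open>V\<close> remains. Over all sources this
  gives \<open>flip\<close>. If \<open>e\<close> starts at a source, that source is absent from the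
  product, and its missing factor is the twist of \<open>e\<close>.\<close>

lemma crossings_parity:
  assumes e: "e \<in> arcs (graph N)"
  shows "(-1) ^ ray_crossings (moved 1) l e = (-1) ^ ray_crossings N l e *
    (if tail (graph N) e = V \<or> head (graph N) e = V
     then flip * (if tail (graph N) e \<in> range (boundary N) then twist e else 1) else 1)"
proof -
  let ?t = "tail (graph N) e" and ?h = "head (graph N) e"
  let ?J = "{j. is_source N j \<and> boundary N j \<noteq> ?t}"
  have vs: "?t \<in> verts (graph N)" "?h \<in> verts (graph N)" "?t \<noteq> ?h"
    using e M0.G.head_in_verts M0.G.tail_in_verts M0.G.no_loops by auto
  define A where "A = (\<lambda>j. side N l j (\<gamma> 1) * side N l j (\<gamma> 0))"
  have "(-1) ^ ray_crossings N l e * (-1) ^ ray_crossings (moved 1) l e =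
    (\<Prod>j\<in>?J. (side N l j (pos N ?t) * side N l j (pos N ?h)) *
      (side N l j (pos (moved 1) ?t) * side N l j (pos (moved 1) ?h)))"
    using M0.ray_crossings_parity[OF e] M1.ray_crossings_parity e
    by (simp add: prod.distrib)
  also have "\<dots> = (\<Prod>j\<in>?J. if ?t = V \<or> ?h = V then A j else 1)"
  proof (rule prod.cong)
    fix j assume j: "j \<in> ?J"
    have s: "side N l j (pos N ?t) * side N l j (pos N ?t) = 1"
      "side N l j (pos N ?h) * side N l j (pos N ?h) = 1"
      using M0.side_square vs j M0.no_edge_into_source[OF _ e] by auto
    have eq: "(a * b) * (a * d) = d * b" if "a * a = 1" for a b d :: real
      using that by (metis (no_types, opaque_lifting) mult.assoc mult.commute mult.left_neutral)
    have eq': "(a * b) * (c * b) = c * a" if "b * b = 1" for a b c :: real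
      using that by (metis (no_types, opaque_lifting) mult.assoc mult.commute mult.left_neutral)
    show "(side N l j (pos N ?t) * side N l j (pos N ?h)) *
      (side N l j (pos (moved 1) ?t) * side N l j (pos (moved 1) ?h)) =
      (if ?t = V \<or> ?h = V then A j else 1)"
      using vs(3) by (auto simp: A_def start s eq[OF s(1)] eq'[OF s(2)])
  qed simp
  also have "\<dots> = (if ?t = V \<or> ?h = V then \<Prod>j\<in>?J. A j else 1)" by simp
  also have "\<dots> = (if ?t = V \<or> ?h = V
     then flip * (if ?t \<in> range (boundary N) then twist e else 1) else 1)"
  proof (cases "?t \<in> range (boundary N)")
    case False
    then have "boundary N j \<noteq> ?t" for j by (metis rangeI)
    then have "?J = {j. is_source N j}" by simp
    then show ?thesis using False by (simp add: flip_def A_def)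
  next
    case True
    then obtain i where i: "?t = boundary N i" by blast
    have "is_source N i" using e i by (auto simp: is_source_def)
    moreover have J: "?J = {j. is_source N j} - {i}"
      using i M0.boundary_inj by (auto simp: inj_def)
    ultimately have "flip = A i * (\<Prod>j\<in>?J. A j)"
      unfolding flip_def J A_def by (intro prod.remove) auto
    moreover have "twist e = A i" if "?h = V" using twist_out_of_source[OF e i that] by (simp add: A_def)
    \<comment> \<open>As \<open>A i\<close> is a sign, dividing it out of \<open>flip\<close> is the
      same as multiplying by it.\<close>
    moreover have "A i * (A i * x) = x" for x
      using side_V_product_square[of i] by (simp add: A_def mult.assoc[symmetric])
    ultimately show ?thesis
      using True V_not_in_range by (cases "?h = V") (auto simp: ac_simps)
  qed
  finally show ?thesis by (rule minus_one_power_cancel)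
qed

section \<open>The corrected solution on the moved network\<close>

definition correction :: "'e \<Rightarrow> real" where
  "correction e = (if tail (graph N) e = V then twist e * flip
     else if tail (graph N) e \<in> internal N then twist e else 1)"

text \<open>In the equation of \<open>e\<close>, the change of winding gives the twists of
  \<open>e\<close> and of each successor \<open>f\<close>, and the latter cancels against the
  correction of \<open>f\<close>. The factor \<open>flip\<close> in the crossings of an edge into
  \<open>V\<close> cancels against the one in the corrections of its successors; for an edge out of
  \<open>V\<close> it stays in its own correction. At a source the crossings contribute the twist
  once more, which leaves correction 1.\<close>

lemma solves_corrected:
  assumes "solves_edge_system N l E"
  shows "solves_edge_system (moved 1) l (\<lambda>e. correction e *\<^sub>R E e)"
  unfolding solves_edge_system_def place_simps
proof (intro conjI ballI impI allI)
  fix e assume e: "e \<in> arcs (graph N)" and h: "head (graph N) e \<in> internal N"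
  let ?O = "out_arcs (graph N) (head (graph N) e)"
  have t: "tail (graph N) e \<in> internal N \<longleftrightarrow> tail (graph N) e \<notin> range (boundary N)"
    using M0.G.tail_in_verts[OF e] by (auto simp: internal_def)
  have ne: "tail (graph N) e \<noteq> head (graph N) e" using M0.G.no_loops[OF e] .
  have Ee: "E e = ((-1) ^ ray_crossings N l e * weight N e) *\<^sub>R
      (\<Sum>f\<in>?O. ((-1) powi wind N l e f) *\<^sub>R E f)"
    using assms e h unfolding solves_edge_system_def by blast
  \<comment> \<open>The factor that can be pulled out of the sum because it is the same for all
    successors \<open>f\<close>.\<close>
  define c where "c = (if head (graph N) e = V then twist e * flip else twist e)"
  have "(-1) powi wind (moved 1) l e f * correction f = c * (-1) powi wind N l e f"
    if "f \<in> ?O" for f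
  proof -
    have f: "f \<in> arcs (graph N)" "head (graph N) e = tail (graph N) f" using that by auto
    have "correction f = (if head (graph N) e = V then twist f * flip else twist f)"
      using f h by (auto simp: correction_def)
    then show ?thesis using wind_parity[OF e f] by (simp add: c_def ac_simps)
  qed
  then have "(\<Sum>f\<in>?O. ((-1) powi wind (moved 1) l e f) *\<^sub>R correction f *\<^sub>R E f) =
      c *\<^sub>R (\<Sum>f\<in>?O. ((-1) powi wind N l e f) *\<^sub>R E f)"
    by (simp add: scaleR_sum_right)
  moreover have "(-1) ^ ray_crossings (moved 1) l e * c = correction e * (-1) ^ ray_crossings N l e"
    using crossings_parity[OF e] t ne twist_nonincident[OF e] V V_not_in_range
    by (cases "tail (graph N) e = V"; cases "head (graph N) e = V";
        cases "tail (graph N) e \<in> range (boundary N)")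
      (simp_all add: c_def correction_def ac_simps)
  ultimately show "correction e *\<^sub>R E e = ((-1) ^ ray_crossings (moved 1) l e * weight N e) *\<^sub>R
      (\<Sum>f\<in>?O. ((-1) powi wind (moved 1) l e f) *\<^sub>R correction f *\<^sub>R E f)"
    by (subst Ee) (simp add: mult_ac)
next
  fix j e assume e_in: "e \<in> in_arcs (graph N) (boundary N j)"
  then have e: "e \<in> arcs (graph N)" "head (graph N) e = boundary N j" by auto
  have Ee: "E e = ((-1) ^ ray_crossings N l e * weight N e) *\<^sub>R axis j 1"
    using assms e_in unfolding solves_edge_system_def by blast
  have h: "head (graph N) e \<noteq> V" using e V_not_boundary[of j] by auto
  \<comment> \<open>At a sink there is no winding term, so the correction must equal the change of
    the crossing sign; the twist is 1 both for an edge out of \<open>V\<close> and for one away from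
    \<open>V\<close>.\<close>
  have "correction e * (-1) ^ ray_crossings N l e = (-1) ^ ray_crossings (moved 1) l e"
  proof (cases "tail (graph N) e = V")
    case True
    moreover from True V have "tail (graph N) e \<notin> range (boundary N)" by (simp add: internal_def)
    ultimately show ?thesis
      using crossings_parity[OF e(1)] twist_into_sink[OF e(1) True e(2)] by (simp add: correction_def)
  next
    case False
    then show ?thesis
      using crossings_parity[OF e(1)] twist_nonincident[OF e(1) False h] h by (simp add: correction_def)
  qed
  then show "correction e *\<^sub>R E e = ((-1) ^ ray_crossings (moved 1) l e * weight N e) *\<^sub>R axis j 1"
    by (subst Ee) simp
qed

lemma correction_nonincident:
  "\<lbrakk>e \<in> arcs (graph N); tail (graph N) e \<noteq> V; head (graph N) e \<noteq> V\<rbrakk> \<Longrightarrow> correction e = 1"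
  using twist_nonincident by (simp add: correction_def)

text \<open>The successor \<open>f\<close> does not touch \<open>V\<close>, so its twist is 1. The
  change of winding is then the twist of \<open>e\<close> and the change of crossings is
  \<open>flip\<close>, which together form the correction.\<close>

lemma correction_outgoing:
  assumes e: "e \<in> arcs (graph N)" "tail (graph N) e = V"
    and f: "f \<in> out_arcs (graph N) (head (graph N) e)"
  shows "correction e = (-1) powi (wind (moved 1) l e f - wind N l e f
    + int (ray_crossings (moved 1) l e) - int (ray_crossings N l e))"
proof -
  have f': "f \<in> arcs (graph N)" "head (graph N) e = tail (graph N) f" using f by auto
  have "head (graph N) f \<noteq> V" "tail (graph N) f \<noteq> V"
    using M0.no_opposite_edge[OF e(1) f'] M0.G.no_loops[OF e(1)] e(2) f'(2) by auto
  then have "twist f = 1" using twist_nonincident[OF f'(1)] by blast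
  then have "(-1) powi wind (moved 1) l e f = (-1) powi wind N l e f * twist e"
    using wind_parity[OF e(1) f'] by simp
  moreover have "tail (graph N) e \<notin> range (boundary N)" using e V by (simp add: internal_def)
  then have "(-1) ^ ray_crossings (moved 1) l e = (-1) ^ ray_crossings N l e * flip"
    using crossings_parity[OF e(1)] e(2) by simp
  ultimately show ?thesis using e(2) unfolding minus_one_powi_diff(1)
    by (simp add: correction_def ac_simps)
qed

lemma correction_outgoing_sink:
  assumes e: "e \<in> arcs (graph N)" "tail (graph N) e = V" "head (graph N) e \<in> range (boundary N)"
  shows "correction e = (-1) powi (int (ray_crossings (moved 1) l e) - int (ray_crossings N l e))"
proof -
  have "twist e = 1" using e twist_into_sink by blast
  moreover have "tail (graph N) e \<notin> range (boundary N)" using e V by (simp add: internal_def)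
  then have "(-1) ^ ray_crossings (moved 1) l e = (-1) ^ ray_crossings N l e * flip"
    using crossings_parity[OF e(1)] e(2) by simp
  ultimately show ?thesis using e(2) unfolding minus_one_powi_diff
    by (simp add: correction_def ac_simps)
qed

text \<open>The predecessor \<open>f\<close> does not touch \<open>V\<close>, so the change of
  winding between \<open>f\<close> and \<open>e\<close> reads off the twist of \<open>e\<close>
  alone.\<close>

lemma correction_incoming:
  assumes e: "e \<in> arcs (graph N)" "head (graph N) e = V" "tail (graph N) e \<in> internal N"
    and f: "f \<in> in_arcs (graph N) (tail (graph N) e)"
  shows "correction e = (-1) powi (wind (moved 1) l f e - wind N l f e)"
proof -
  have f': "f \<in> arcs (graph N)" "head (graph N) f = tail (graph N) e" using f by auto
  have tV: "tail (graph N) e \<noteq> V" using M0.G.no_loops[OF e(1)] e(2) by simp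
  moreover have "tail (graph N) f \<noteq> V" using M0.no_opposite_edge[OF f'(1) e(1) f'(2)] e(2) by simp
  ultimately have "twist f = 1" using twist_nonincident[OF f'(1)] f'(2) by simp
  then have "(-1) powi wind (moved 1) l f e = (-1) powi wind N l f e * twist e"
    using wind_parity[OF f'(1) e(1) f'(2)] by simp
  then show ?thesis using e(3) tV unfolding minus_one_powi_diff
    by (simp add: correction_def ac_simps)
qed

lemma correction_incoming_source:
  assumes "e \<in> arcs (graph N)" "head (graph N) e = V" "tail (graph N) e \<in> range (boundary N)"
  shows "correction e = 1"
  using assms M0.G.no_loops[OF assms(1)] by (simp add: correction_def internal_def)

end

theorem lemma4p12:
  fixes D S :: "complex set"
    and N N' :: "('v, 'e, 'n::{finite,linorder}) network"
    and l :: complex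
    and V :: 'v
    and e1 e2 e3 :: 'e
    and E E' :: "'e \<Rightarrow> real ^ 'n::{finite,linorder}"
  assumes "plabic_network D S N"
    and "vertex_gauge_move D S N V N'"
    and "gauge_direction D N l"
    and "gauge_direction D N' l"
    and "edge_vectors N l E"
    and "edge_vectors N' l E'"
    and "degree N V = 3"
  shows
    "(colour N V = White \<and> e1 \<noteq> e2 \<and>
      in_arcs (graph N) V = {e3} \<and> out_arcs (graph N) V = {e1, e2} \<longrightarrow>
        (\<forall>e\<in>arcs (graph N) - {e1, e2, e3}. E' e = E e) \<and>
        (\<forall>e\<in>{e1, e2}.
          (head (graph N) e \<in> internal N \<longrightarrow>
            (\<forall>f\<in>out_arcs (graph N) (head (graph N) e).
              E' e = ((-1) powi (wind N' l e f - wind N l e f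
                        + int (ray_crossings N' l e) - int (ray_crossings N l e))) *\<^sub>R E e)) \<and>
          (head (graph N) e \<in> range (boundary N) \<longrightarrow>
            E' e = ((-1) powi (int (ray_crossings N' l e) - int (ray_crossings N l e))) *\<^sub>R E e)) \<and>
        (tail (graph N) e3 \<in> internal N \<longrightarrow>
          (\<forall>f\<in>in_arcs (graph N) (tail (graph N) e3).
            E' e3 = ((-1) powi (wind N' l f e3 - wind N l f e3)) *\<^sub>R E e3)) \<and>
        (tail (graph N) e3 \<in> range (boundary N) \<longrightarrow> E' e3 = E e3))
     \<and>
     (colour N V = Black \<and> e2 \<noteq> e3 \<and>
      out_arcs (graph N) V = {e1} \<and> in_arcs (graph N) V = {e2, e3} \<longrightarrow>
        (\<forall>e\<in>arcs (graph N) - {e1, e2, e3}. E' e = E e) \<and>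
        (head (graph N) e1 \<in> internal N \<longrightarrow>
          (\<forall>f\<in>out_arcs (graph N) (head (graph N) e1).
            E' e1 = ((-1) powi (wind N' l e1 f - wind N l e1 f
                       + int (ray_crossings N' l e1) - int (ray_crossings N l e1))) *\<^sub>R E e1)) \<and>
        (head (graph N) e1 \<in> range (boundary N) \<longrightarrow>
          E' e1 = ((-1) powi (int (ray_crossings N' l e1) - int (ray_crossings N l e1))) *\<^sub>R E e1) \<and>
        (\<forall>e\<in>{e2, e3}.
          (tail (graph N) e \<in> internal N \<longrightarrow>
            (\<forall>f\<in>in_arcs (graph N) (tail (graph N) e).
              E' e = ((-1) powi (wind N' l f e - wind N l f e)) *\<^sub>R E e)) \<and>
          (tail (graph N) e \<in> range (boundary N) \<longrightarrow> E' e = E e)))"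
proof -
  from assms(2) obtain \<gamma> where \<gamma>: "path \<gamma>" "pathstart \<gamma> = pos N V"
      "N' = place N V (pathfinish \<gamma>)" "\<forall>t\<in>{0..1}. plabic_network D S (place N V (\<gamma> t))"
    and V: "V \<in> internal N"
    unfolding vertex_gauge_move_def by blast
  have N': "N' = place N V (\<gamma> 1)" using \<gamma>(3) by (simp add: pathfinish_def)
  interpret vertex_move D S N V \<gamma> l
    by (rule vertex_move.intro) (use \<gamma> V assms(3,4) N' in \<open>simp_all add: pathstart_def\<close>)
  have "solves_edge_system N' l (\<lambda>e. correction e *\<^sub>R E e)"
    using solves_corrected assms(5) unfolding edge_vectors_def N' by blast
  then have E': "E' e = correction e *\<^sub>R E e" if "e \<in> arcs (graph N)" for e
    using assms(6) that unfolding edge_vectors_def N' place_simps by metis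
  \<comment> \<open>The formulas are established for arbitrary outgoing and incoming edges at
    \<open>V\<close>; substituting the given arc sets yields the white and the black case.\<close>
  have "\<forall>e\<in>arcs (graph N) - (in_arcs (graph N) V \<union> out_arcs (graph N) V). E' e = E e"
    using E' correction_nonincident by auto
  moreover have "\<forall>e\<in>out_arcs (graph N) V.
      (head (graph N) e \<in> internal N \<longrightarrow> (\<forall>f\<in>out_arcs (graph N) (head (graph N) e).
        E' e = ((-1) powi (wind N' l e f - wind N l e f
          + int (ray_crossings N' l e) - int (ray_crossings N l e))) *\<^sub>R E e)) \<and>
      (head (graph N) e \<in> range (boundary N) \<longrightarrow>
        E' e = ((-1) powi (int (ray_crossings N' l e) - int (ray_crossings N l e))) *\<^sub>R E e)"
    using E' correction_outgoing correction_outgoing_sink by (simp add: N')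
  moreover have "\<forall>e\<in>in_arcs (graph N) V.
      (tail (graph N) e \<in> internal N \<longrightarrow> (\<forall>f\<in>in_arcs (graph N) (tail (graph N) e).
        E' e = ((-1) powi (wind N' l f e - wind N l f e)) *\<^sub>R E e)) \<and>
      (tail (graph N) e \<in> range (boundary N) \<longrightarrow> E' e = E e)"
    using E' correction_incoming correction_incoming_source by (simp add: N')
  ultimately show ?thesis
    by (intro conjI[of "_ \<longrightarrow> _"] impI; elim conjE) (simp_all add: insert_commute)
qed

end
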